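(* $\mathcal{M}^{iso}$ is not accumulated; that is, there exists $H\subset\mathbb{R}$ with $H,H'\in Dom(\mathcal{M}^{iso})$ and $\mathcal{M}^{iso}(H')\ne\mathcal{M}^{iso}(H)$.
   Context: $H'$ is the set of accumulation points of $H\subset\mathbb{R}$, $cl(H)$ its closure, $A-B$ is set difference. For a finite nonempty set $F\subset\mathbb{R}$, $\mathcal{A}(F)$ is the arithmetic mean of its elements. For $K\subset\mathbb{R}$, $\delta>0$: $S(K,\delta)=\{y\in\mathbb{R}:\exists x\in K,\ |x-y|<\delta\}$. Definition of $\mathcal{M}^{iso}$: for a nonempty bounded $H\subset\mathbb{R}$ with $cl(H-H')=H$, let $\mathcal{M}^{iso}(H)=\lim_{\delta\to 0+0}\mathcal{A}(H-S(H',\delta))$ if the limit exists (note that $H-S(H',\delta)$ is finite). $Dom(\mathcal{M}^{iso})$ is the set of all such $H$ for which the limit exists. A function $\mathcal{K}$ defined on some bounded subsets of $\mathbb{R}$ is called accumulated if $H,H'\in Dom(\mathcal{K})$ implies $\mathcal{K}(H')=\mathcal{K}(H)$. *)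

theory Defs
  imports "HOL-Analysis.Analysis"
begin

definition accumulation_points :: "real set \<Rightarrow> real set" where
  "accumulation_points H = {x. x islimpt H}"

definition nbhd :: "real set \<Rightarrow> real \<Rightarrow> real set" where
  "nbhd K \<delta> = {y. \<exists>x\<in>K. \<bar>x - y\<bar> < \<delta>}"

(* Meaningful only for finite nonempty F. *)
definition arith_mean :: "real set \<Rightarrow> real" where
  "arith_mean F = (\<Sum>x\<in>F. x) / real (card F)"

(* The mean is a partial function on sets of reals, so that Dom is the library's dom.
   If H is nonempty and bounded with closure (H - H') = H, then H - nbhd H' d is finite for
   every d > 0 and nonempty for all small d > 0, so the value that arith_mean takes on the
   empty set does not influence the limit. *)
definition M_iso :: "real set \<rightharpoonup> real" where
  "M_iso H =
    (let H' = accumulation_points H;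
         m = (\<lambda>\<delta>. arith_mean (H - nbhd H' \<delta>))
     in if H \<noteq> {} \<and> bounded H \<and> closure (H - H') = H \<and> (\<exists>l. (m \<longlongrightarrow> l) (at_right 0))
        then Some (Lim (at_right 0) m) else None)"

definition accumulated :: "(real set \<rightharpoonup> real) \<Rightarrow> bool" where
  "accumulated K \<longleftrightarrow>
    (\<forall>H. H \<in> dom K \<and> accumulation_points H \<in> dom K \<longrightarrow> K (accumulation_points H) = K H)"

end

theory Submission
  imports Defs "HOL-Real_Asymp.Real_Asymp"
begin

text \<open>
  Put \<open>a\<^sub>k = 2\<^sup>-\<^sup>k\<^sup>-\<^sup>2\<close> and let \<open>H\<close> consist of \<open>0\<close>, \<open>1\<close> and all points \<open>a\<^sub>k\<close>, \<open>- a\<^sub>k\<close>, \<open>1 + a\<^sub>k\<close>.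
  Then \<open>H' = {0, 1}\<close> has mean \<open>1/2\<close>. The point \<open>0\<close> is approached from both sides and \<open>1\<close> from one
  side at the same speed, so two thirds of the points remaining outside a neighbourhood of \<open>H'\<close>
  lie near \<open>0\<close> and one third near \<open>1\<close>, and the mean of \<open>H\<close> is \<open>1/3\<close>.
\<close>

lemma M_iso_eqI:
  assumes "H \<noteq> {}" "bounded H" "closure (H - accumulation_points H) = H"
    and "((\<lambda>\<delta>. arith_mean (H - nbhd (accumulation_points H) \<delta>)) \<longlongrightarrow> l) (at_right 0)"
  shows "M_iso H = Some l"
proof -
  have "Lim (at_right 0) (\<lambda>\<delta>. arith_mean (H - nbhd (accumulation_points H) \<delta>)) = l"
    using assms(4) by (intro tendsto_Lim) auto
  then show ?thesis
    using assms by (auto simp: M_iso_def Let_def)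
qed

text \<open>A finite set has no accumulation points, so nothing is removed and the mean is constant
  in \<delta>. This handles the derived set of the witness.\<close>

lemma M_iso_finite:
  assumes "finite H" "H \<noteq> {}"
  shows "M_iso H = Some (arith_mean H)"
proof (rule M_iso_eqI)
  have "accumulation_points H = {}"
    using assms by (auto simp: accumulation_points_def islimpt_finite)
  then show "closure (H - accumulation_points H) = H"
    and "((\<lambda>\<delta>. arith_mean (H - nbhd (accumulation_points H) \<delta>)) \<longlongrightarrow> arith_mean H) (at_right 0)"
    using assms by (auto simp: nbhd_def finite_imp_closed)
qed (use assms in \<open>auto simp: finite_imp_bounded\<close>)

text \<open>A convergent sequence can accumulate only at its limit. Since \<open>f\<close> never
  attains \<open>l\<close>, its terms approach \<open>l\<close> through other points, so
  \<open>l\<close> is indeed a limit point.\<close>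

lemma islimpt_range_iff:
  fixes f :: "nat \<Rightarrow> real"
  assumes "f \<longlonglongrightarrow> l" "\<And>n. f n \<noteq> l"
  shows "x islimpt range f \<longleftrightarrow> x = l"
proof
  show "x islimpt range f \<Longrightarrow> x = l"
    using sequence_unique_limpt[OF assms(1)] by simp
  show "x = l \<Longrightarrow> x islimpt range f"
    using assms by (auto simp: islimpt_sequential)
qed

text \<open>The exponent starts at 2 to bound all terms by 1/4, which keeps the three families
  disjoint and each well away from the other accumulation point.\<close>

definition dyad :: "nat \<Rightarrow> real" where
  "dyad k = (1/2) ^ (k + 2)"

lemma dyad_pos: "dyad k > 0"
  by (simp add: dyad_def)

lemma dyad_le: "dyad k \<le> 1/4"
  using power_le_one[of "1/2 :: real" k] by (simp add: dyad_def)

lemma dyad_less_iff: "dyad m < dyad n \<longleftrightarrow> n < m"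
  by (simp add: dyad_def)

lemma dyad_le_iff: "dyad m \<le> dyad n \<longleftrightarrow> n \<le> m"
  using dyad_less_iff[of n m] by linarith

lemma inj_dyad: "inj dyad"
  by (intro injI antisym) (simp_all flip: dyad_le_iff)

lemma dyad_tendsto_0: "dyad \<longlonglongrightarrow> 0"
  unfolding dyad_def by real_asymp

lemma sum_dyad: "(\<Sum>k<n. dyad k) = (1 - (1/2)^n) / 2"
  by (induction n) (simp_all add: dyad_def field_simps)

definition isolated_set :: "real set" where
  "isolated_set = range dyad \<union> range (\<lambda>k. - dyad k) \<union> range (\<lambda>k. 1 + dyad k)"

definition witness_set :: "real set" where
  "witness_set = insert 0 (insert 1 isolated_set)"

lemma islimpt_isolated_set: "x islimpt isolated_set \<longleftrightarrow> x = 0 \<or> x = 1"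
proof -
  have "(\<lambda>k. - dyad k) \<longlonglongrightarrow> 0" "(\<lambda>k. 1 + dyad k) \<longlonglongrightarrow> 1"
    using tendsto_minus[OF dyad_tendsto_0] tendsto_add[OF tendsto_const dyad_tendsto_0] by auto
  with dyad_tendsto_0 have "x islimpt range dyad \<longleftrightarrow> x = 0" "x islimpt range (\<lambda>k. - dyad k) \<longleftrightarrow> x = 0"
    "x islimpt range (\<lambda>k. 1 + dyad k) \<longleftrightarrow> x = 1"
    using dyad_pos by (simp_all add: islimpt_range_iff less_imp_neq[symmetric])
  then show ?thesis
    by (auto simp: isolated_set_def islimpt_Un)
qed

lemma accumulation_points_witness_set: "accumulation_points witness_set = {0, 1}"
  by (auto simp: accumulation_points_def witness_set_def islimpt_insert islimpt_isolated_set)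

lemma isolated_set_disjoint: "0 \<notin> isolated_set" "1 \<notin> isolated_set"
proof -
  have "dyad k > 0" "dyad k \<noteq> 1" "- dyad k \<noteq> 1" "1 + dyad k \<noteq> 0" for k
    using dyad_pos[of k] dyad_le[of k] by linarith+
  then show "0 \<notin> isolated_set" "1 \<notin> isolated_set"
    by (auto simp: isolated_set_def less_le)
qed

text \<open>Removing 0 and 1 leaves \<open>isolated_set\<close>, whose limit points are exactly 0
  and 1, so the closure restores them.\<close>

lemma closure_witness_isolated: "closure (witness_set - {0, 1}) = witness_set"
proof -
  have "witness_set - {0, 1} = isolated_set"
    using isolated_set_disjoint by (auto simp: witness_set_def)
  then show ?thesis
    by (auto simp: closure_def islimpt_isolated_set witness_set_def)
qed

lemma bounded_witness_set: "bounded witness_set"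
proof -
  have "\<bar>x\<bar> \<le> 2" if "x \<in> witness_set" for x
  proof -
    have "\<bar>dyad k\<bar> \<le> 2" "\<bar>1 + dyad k\<bar> \<le> 2" for k
      using dyad_pos[of k] dyad_le[of k] by linarith+
    with that show ?thesis
      by (auto simp: witness_set_def isolated_set_def)
  qed
  then show ?thesis
    by (auto simp: bounded_iff)
qed

text \<open>As \<open>dyad\<close> is decreasing, for \<delta> > 0 this index is also the number of
  terms that are at least \<delta>.\<close>

definition first_below :: "real \<Rightarrow> nat" where
  "first_below \<delta> = (LEAST k. dyad k < \<delta>)"

lemma less_first_below_iff:
  assumes "\<delta> > 0"
  shows "k < first_below \<delta> \<longleftrightarrow> \<delta> \<le> dyad k"
proof
  show "k < first_below \<delta> \<Longrightarrow> \<delta> \<le> dyad k"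
    using not_less_Least[of k "\<lambda>k. dyad k < \<delta>"] by (simp add: first_below_def)
next
  \<comment> \<open>\<open>LEAST\<close> says something only once some term lies below \<delta>;
    convergence to 0 supplies one.\<close>
  have "\<exists>k. dyad k < \<delta>"
    using order_tendstoD(2)[OF dyad_tendsto_0 assms] by (auto dest: eventually_happens)
  then have "dyad (first_below \<delta>) < \<delta>"
    unfolding first_below_def by (rule LeastI_ex)
  moreover assume "\<delta> \<le> dyad k"
  ultimately show "k < first_below \<delta>"
    by (simp flip: dyad_less_iff)
qed

text \<open>This turns the limit in \<delta> into the limit of a sequence indexed by the number of
  surviving terms per family.\<close>

lemma filterlim_first_below: "filterlim first_below at_top (at_right 0)"
  unfolding filterlim_at_top
proof
  fix n
  have "n \<le> first_below \<delta>" if "\<delta> \<in> {0<..<dyad n}" for \<delta>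
    using that less_first_below_iff[of \<delta> n] by auto
  then show "\<forall>\<^sub>F \<delta> in at_right 0. n \<le> first_below \<delta>"
    using eventually_at_right_real[OF dyad_pos[of n]] by (rule eventually_mono[rotated])
qed

text \<open>Each family loses exactly its terms with \<open>dyad k\<close> < \<delta>. For \<delta>
  < 1/2 the neighbourhood of one accumulation point cannot reach the points clustering at the
  other.\<close>

lemma witness_set_minus_nbhd:
  assumes "0 < \<delta>" "\<delta> < 1/2"
  defines "K \<equiv> {..<first_below \<delta>}"
  shows "witness_set - nbhd {0, 1} \<delta> = dyad ` K \<union> (\<lambda>k. - dyad k) ` K \<union> (\<lambda>k. 1 + dyad k) ` K"
proof -
  have "k \<in> K \<longleftrightarrow> \<delta> \<le> dyad k" for k
    using less_first_below_iff[OF assms(1)] by (simp add: K_def)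
  moreover have "dyad k \<notin> nbhd {0, 1} \<delta> \<longleftrightarrow> \<delta> \<le> dyad k" "- dyad k \<notin> nbhd {0, 1} \<delta> \<longleftrightarrow> \<delta> \<le> dyad k"
    "1 + dyad k \<notin> nbhd {0, 1} \<delta> \<longleftrightarrow> \<delta> \<le> dyad k" for k
    using assms dyad_pos[of k] dyad_le[of k] by (auto simp: nbhd_def)
  moreover have "0 \<in> nbhd {0, 1} \<delta>" "1 \<in> nbhd {0, 1} \<delta>"
    using assms by (auto simp: nbhd_def)
  ultimately show ?thesis
    by (auto simp: witness_set_def isolated_set_def)
qed

lemma arith_mean_witness_part:
  fixes n :: nat
  defines "K \<equiv> {..<n}"
  shows "arith_mean (dyad ` K \<union> (\<lambda>k. - dyad k) ` K \<union> (\<lambda>k. 1 + dyad k) ` K)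
    = (real n + (1 - (1/2)^n) / 2) / (3 * real n)"
proof -
  let ?A = "dyad ` K" and ?B = "(\<lambda>k. - dyad k) ` K" and ?C = "(\<lambda>k. 1 + dyad k) ` K"
  have "dyad j \<noteq> - dyad k" "1 + dyad k \<noteq> dyad j" "1 + dyad k \<noteq> - dyad j" for j k
    using dyad_pos[of j] dyad_pos[of k] dyad_le[of j] by linarith+
  then have disj: "?A \<inter> ?B = {}" "(?A \<union> ?B) \<inter> ?C = {}"
    by auto
  have inj: "inj_on dyad K" "inj_on (\<lambda>k. - dyad k) K" "inj_on (\<lambda>k. 1 + dyad k) K"
    using inj_dyad by (auto simp: inj_on_def)
  have K: "finite K" "card K = n"
    by (simp_all add: K_def)
  have "card (?A \<union> ?B \<union> ?C) = card ?A + card ?B + card ?C"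
    using K(1) disj by (subst card_Un_disjoint; simp)+
  also have "\<dots> = 3 * n"
    using K(2) by (simp add: card_image[OF inj(1)] card_image[OF inj(2)] card_image[OF inj(3)])
  finally have card: "card (?A \<union> ?B \<union> ?C) = 3 * n" .
  have "\<Sum>(?A \<union> ?B \<union> ?C) = \<Sum>?A + \<Sum>?B + \<Sum>?C"
    using K(1) disj by (subst sum.union_disjoint; simp)+
  \<comment> \<open>The families \<open>dyad\<close> and \<open>- dyad\<close> cancel; only the one
    around 1 contributes.\<close>
  also have "\<dots> = real n + (\<Sum>k\<in>K. dyad k)"
    using K(2) by (simp add: sum.reindex[OF inj(1)] sum.reindex[OF inj(2)] sum.reindex[OF inj(3)]
      sum_negf sum.distrib)
  finally have "\<Sum>(?A \<union> ?B \<union> ?C) = real n + (1 - (1/2)^n) / 2"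
    by (simp add: K_def sum_dyad)
  with card show ?thesis
    by (simp add: arith_mean_def)
qed

lemma M_iso_witness_set: "M_iso witness_set = Some (1/3)"
proof (rule M_iso_eqI)
  have "(\<lambda>n. (real n + (1 - (1/2)^n) / 2) / (3 * real n)) \<longlonglongrightarrow> 1/3"
    by real_asymp
  from filterlim_compose[OF this filterlim_first_below]
  show "((\<lambda>\<delta>. arith_mean (witness_set - nbhd (accumulation_points witness_set) \<delta>)) \<longlongrightarrow> 1/3) (at_right 0)"
  proof (rule Lim_transform_eventually)
    \<comment> \<open>The closed formula is known only for 0 < \<delta> < 1/2, which is enough for a
      limit at 0 from the right.\<close>
    have "\<forall>\<^sub>F \<delta> in at_right 0. \<delta> \<in> {0<..<1/2 :: real}"
      by (rule eventually_at_right_real) simp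
    then show "\<forall>\<^sub>F \<delta> in at_right 0.
      (real (first_below \<delta>) + (1 - (1/2) ^ first_below \<delta>) / 2) / (3 * real (first_below \<delta>))
      = arith_mean (witness_set - nbhd (accumulation_points witness_set) \<delta>)"
      by eventually_elim
        (simp add: accumulation_points_witness_set witness_set_minus_nbhd arith_mean_witness_part)
  qed
qed (auto simp: accumulation_points_witness_set closure_witness_isolated bounded_witness_set,
     simp add: witness_set_def)

theorem theorem3p6:
  "\<not> accumulated M_iso \<and>
   (\<exists>H. H \<in> dom M_iso \<and> accumulation_points H \<in> dom M_iso \<and>
        M_iso (accumulation_points H) \<noteq> M_iso H)"
proof -
  have "M_iso (accumulation_points witness_set) = Some (1/2)"
    by (simp add: accumulation_points_witness_set M_iso_finite arith_mean_def)
  with M_iso_witness_set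
  have "witness_set \<in> dom M_iso \<and> accumulation_points witness_set \<in> dom M_iso \<and>
        M_iso (accumulation_points witness_set) \<noteq> M_iso witness_set"
    by auto
  then show ?thesis
    unfolding accumulated_def by blast
qed

end
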